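(* The Cartan canonical $\Gamma_{[3]}$-linear connection produced by the rheonomic Chernov metric $$F_{[3]}(t,y)=\sqrt{h^{11}(t)}\cdot\sqrt[3]{y_1^1y_1^2y_1^3+y_1^1y_1^2y_1^4+y_1^1y_1^3y_1^4+y_1^2y_1^3y_1^4}$$ has the following adapted local components: $$C\Gamma_{[3]}=\left(\varkappa_{11}^1,\ \ G_{j1}^k=0,\ \ L_{jk}^i=\frac{\varkappa_{11}^1}{2}C_{j(k)}^{i(1)},\ \ C_{j(k)}^{i(1)}\right),$$ where $$C_{j(k)}^{i(1)}=3S_{[3]}^{im1}S_{[3]jkm}-\frac16\frac{1}{S_{[3]111}}\left[S_{[3]jk1}\frac{y_1^i}{2}+\delta_j^iS_{[3]k11}+\delta_k^iS_{[3]j11}\right]+\frac19\frac{1}{S_{[3]111}^2}S_{[3]j11}S_{[3]k11}\,y_1^i .$$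
   Context: $M^4$ is a smooth $4$-dimensional manifold with local coordinates $(x^1,\dots,x^4)$; $J^1(\mathbb{R},M^4)$ has local coordinates $(t,x^1,\dots,x^4,y_1^1,\dots,y_1^4)$. $h_{11}(t)>0$ is a Riemannian metric on $\mathbb{R}$, $h^{11}=1/h_{11}$, and $\varkappa_{11}^1=\frac{h^{11}}{2}\frac{dh_{11}}{dt}$. Latin indices run from $1$ to $4$, repeated indices are summed; cube roots are real. Notation: $S_{[3]111}=y_1^1y_1^2y_1^3+y_1^1y_1^2y_1^4+y_1^1y_1^3y_1^4+y_1^2y_1^3y_1^4$; $S_{[3]i11}=\partial S_{[3]111}/\partial y_1^i$; $S_{[3]ij1}=\partial^2S_{[3]111}/\partial y_1^i\partial y_1^j$; $S_{[3]ijk}=\frac1{3!}$ if $i,j,k$ are distinct and $0$ otherwise. Everything is considered on the open set where $S_{[3]111}\ne0$ and $(S_{[3]ij1})$ is invertible; $(S_{[3]}^{jk1})$ is the inverse matrix. The fundamental metrical d-tensor is $g_{[3]ij}=\frac{h_{11}}{2}\frac{\partial^2F_{[3]}^2}{\partial y_1^i\partial y_1^j}$, with inverse $(g_{[3]}^{jk})$. The canonical nonlinear connection of $F_{[3]}$ is $\Gamma_{[3]}=(M_{(1)1}^{(i)}=-\varkappa_{11}^1y_1^i,\ N_{(1)j}^{(i)}=-\frac{\varkappa_{11}^1}{2}\delta_j^i)$, giving the adapted derivations $$\frac{\delta}{\delta t}=\frac{\partial}{\partial t}+\varkappa_{11}^1y_1^p\frac{\partial}{\partial y_1^p},\qquad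 \frac{\delta}{\delta x^i}=\frac{\partial}{\partial x^i}+\frac{\varkappa_{11}^1}{2}\frac{\partial}{\partial y_1^i},\qquad\frac{\partial}{\partial y_1^i}.$$ The Cartan canonical $\Gamma_{[3]}$-linear connection is the connection with adapted components $(\varkappa_{11}^1,G_{j1}^k,L_{jk}^i,C_{j(k)}^{i(1)})$ defined by $$G_{j1}^k=\frac{g_{[3]}^{km}}{2}\frac{\delta g_{[3]mj}}{\delta t},\qquad L_{jk}^i=\frac{g_{[3]}^{im}}{2}\left(\frac{\delta g_{[3]jm}}{\delta x^k}+\frac{\delta g_{[3]km}}{\delta x^j}-\frac{\delta g_{[3]jk}}{\delta x^m}\right),$$ $$C_{j(k)}^{i(1)}=\frac{g_{[3]}^{im}}{2}\left(\frac{\partial g_{[3]jm}}{\partial y_1^k}+\frac{\partial g_{[3]km}}{\partial y_1^j}-\frac{\partial g_{[3]jk}}{\partial y_1^m}\right).$$ *)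

theory Defs
  imports "HOL-Analysis.Analysis"
begin

text \<open>
  Everything is written in one local chart \<open>(t, x, y)\<close> of \<open>J\<^sup>1(\<real>, M\<^sup>4)\<close>. Objects on the jet
  space are functions of all three arguments, so that the operators below may differentiate in
  any of them, even where a concrete object (such as the Chernov metric) does not depend on \<open>x\<close>.
  In the type \<open>4\<close> the numeral 4 is the same index as 0, so \<open>y $ 1, ..., y $ 4\<close> are the
  four distinct coordinates.
\<close>

type_synonym jet_function = "real \<Rightarrow> real ^ 4 \<Rightarrow> real ^ 4 \<Rightarrow> real"

definition partial :: "4 \<Rightarrow> (real ^ 4 \<Rightarrow> real) \<Rightarrow> real ^ 4 \<Rightarrow> real" where
  "partial i f v = deriv (\<lambda>s. f (v + s *\<^sub>R axis i 1)) 0"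

definition smooth_real :: "(real \<Rightarrow> real) \<Rightarrow> bool" where
  "smooth_real f \<longleftrightarrow> (\<forall>n t. ((deriv ^^ n) f) differentiable (at t))"

definition riemannian_metric_line :: "(real \<Rightarrow> real) \<Rightarrow> bool" where
  "riemannian_metric_line h \<longleftrightarrow> smooth_real h \<and> (\<forall>t. h t > 0)"

definition h_up :: "(real \<Rightarrow> real) \<Rightarrow> real \<Rightarrow> real" where
  "h_up h t = 1 / h t"

definition kappa :: "(real \<Rightarrow> real) \<Rightarrow> real \<Rightarrow> real" where
  "kappa h t = h_up h t / 2 * deriv h t"

definition kron :: "4 \<Rightarrow> 4 \<Rightarrow> real" where
  "kron i j = (if i = j then 1 else 0)"


subsection \<open>The Chernov form and metric\<close>

definition S :: "real ^ 4 \<Rightarrow> real" where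
  "S y = y $ 1 * y $ 2 * y $ 3 + y $ 1 * y $ 2 * y $ 4 + y $ 1 * y $ 3 * y $ 4
       + y $ 2 * y $ 3 * y $ 4"

definition S1 :: "4 \<Rightarrow> real ^ 4 \<Rightarrow> real" where
  "S1 i y = partial i S y"

definition S2 :: "4 \<Rightarrow> 4 \<Rightarrow> real ^ 4 \<Rightarrow> real" where
  "S2 i j y = partial i (partial j S) y"

text \<open>\<open>S3\<close> is the polarised coefficient of the cubic form, i.e. one sixth of its third partial
  derivative.\<close>

definition S3 :: "4 \<Rightarrow> 4 \<Rightarrow> 4 \<Rightarrow> real" where
  "S3 i j k = (if i \<noteq> j \<and> i \<noteq> k \<and> j \<noteq> k then 1 / fact 3 else 0)"

definition S2_matrix :: "real ^ 4 \<Rightarrow> real ^ 4 ^ 4" where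
  "S2_matrix y = (\<chi> i j. S2 i j y)"

definition S2_inv :: "4 \<Rightarrow> 4 \<Rightarrow> real ^ 4 \<Rightarrow> real" where
  "S2_inv j k y = matrix_inv (S2_matrix y) $ j $ k"

text \<open>\<open>root 3\<close> is the real cube root, also for negative arguments.\<close>

definition chernov_F :: "(real \<Rightarrow> real) \<Rightarrow> jet_function" where
  "chernov_F h t x y = sqrt (h_up h t) * root 3 (S y)"


subsection \<open>Fundamental metrical d-tensor, nonlinear connection, Cartan connection\<close>

definition metric :: "(real \<Rightarrow> real) \<Rightarrow> jet_function \<Rightarrow> 4 \<Rightarrow> 4 \<Rightarrow> jet_function" where
  "metric h F i j t x y = h t / 2 * partial i (partial j (\<lambda>z. (F t x z)\<^sup>2)) y"

definition metric_inv :: "(real \<Rightarrow> real) \<Rightarrow> jet_function \<Rightarrow> 4 \<Rightarrow> 4 \<Rightarrow> jet_function" where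
  "metric_inv h F j k t x y = matrix_inv (\<chi> a b. metric h F a b t x y) $ j $ k"

definition M_conn :: "(real \<Rightarrow> real) \<Rightarrow> 4 \<Rightarrow> jet_function" where
  "M_conn h i t x y = - kappa h t * y $ i"

definition N_conn :: "(real \<Rightarrow> real) \<Rightarrow> 4 \<Rightarrow> 4 \<Rightarrow> jet_function" where
  "N_conn h i j t x y = - (kappa h t / 2) * kron i j"

definition delta_t :: "(real \<Rightarrow> real) \<Rightarrow> jet_function \<Rightarrow> jet_function" where
  "delta_t h f t x y =
     deriv (\<lambda>s. f s x y) t - (\<Sum>p\<in>UNIV. M_conn h p t x y * partial p (f t x) y)"

definition delta_x :: "(real \<Rightarrow> real) \<Rightarrow> 4 \<Rightarrow> jet_function \<Rightarrow> jet_function" where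
  "delta_x h i f t x y =
     partial i (\<lambda>z. f t z y) x - (\<Sum>p\<in>UNIV. N_conn h p i t x y * partial p (f t x) y)"

definition delta_y :: "4 \<Rightarrow> jet_function \<Rightarrow> jet_function" where
  "delta_y i f t x y = partial i (f t x) y"

lemma delta_t_eq:
  "delta_t h f t x y =
     deriv (\<lambda>s. f s x y) t + kappa h t * (\<Sum>p\<in>UNIV. y $ p * partial p (f t x) y)"
  by (simp add: delta_t_def M_conn_def sum_negf sum_distrib_left mult.assoc)

lemma delta_x_eq:
  "delta_x h i f t x y = partial i (\<lambda>z. f t z y) x + kappa h t / 2 * partial i (f t x) y"
  by (simp add: delta_x_def N_conn_def kron_def sum_negf if_distrib if_distribR cong: if_cong)

text \<open>In the components below the upper index is the first index argument.\<close>

definition cartan_G :: "(real \<Rightarrow> real) \<Rightarrow> jet_function \<Rightarrow> 4 \<Rightarrow> 4 \<Rightarrow> jet_function" where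
  "cartan_G h F k j t x y =
     (\<Sum>m\<in>UNIV. metric_inv h F k m t x y / 2 * delta_t h (metric h F m j) t x y)"

definition cartan_L :: "(real \<Rightarrow> real) \<Rightarrow> jet_function \<Rightarrow> 4 \<Rightarrow> 4 \<Rightarrow> 4 \<Rightarrow> jet_function" where
  "cartan_L h F i j k t x y =
     (\<Sum>m\<in>UNIV. metric_inv h F i m t x y / 2 *
        (delta_x h k (metric h F j m) t x y + delta_x h j (metric h F k m) t x y
         - delta_x h m (metric h F j k) t x y))"

definition cartan_C :: "(real \<Rightarrow> real) \<Rightarrow> jet_function \<Rightarrow> 4 \<Rightarrow> 4 \<Rightarrow> 4 \<Rightarrow> jet_function" where
  "cartan_C h F i j k t x y =
     (\<Sum>m\<in>UNIV. metric_inv h F i m t x y / 2 *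
        (delta_y k (metric h F j m) t x y + delta_y j (metric h F k m) t x y
         - delta_y m (metric h F j k) t x y))"

definition cartan_connection ::
  "(real \<Rightarrow> real) \<Rightarrow> jet_function \<Rightarrow> real \<Rightarrow> real ^ 4 \<Rightarrow> real ^ 4 \<Rightarrow>
     real \<times> (4 \<Rightarrow> 4 \<Rightarrow> real) \<times> (4 \<Rightarrow> 4 \<Rightarrow> 4 \<Rightarrow> real) \<times> (4 \<Rightarrow> 4 \<Rightarrow> 4 \<Rightarrow> real)" where
  "cartan_connection h F t x y =
     (kappa h t,
      \<lambda>k j. cartan_G h F k j t x y,
      \<lambda>i j k. cartan_L h F i j k t x y,
      \<lambda>i j k. cartan_C h F i j k t x y)"

end

theory Submission
  imports Defs
begin

text \<open>
  By Euler's identities \<open>S2 i j y\<^sup>j = 2 S1 i\<close> and \<open>S1 i y\<^sup>i = 3 S\<close>, the metric, a rank-one perturbation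
  of a multiple of \<open>S2\<close>, has inverse \<open>3 S\<^sup>1\<^sup>/\<^sup>3 (S2\<^sup>-\<^sup>1 + y y\<^sup>T / (6 S))\<close>. Its first \<open>y\<close>-derivatives are
  totally symmetric, so \<open>C\<close> is half the contraction of this inverse with them, and \<open>y y\<^sup>T\<close> does not
  contribute because the metric is homogeneous of degree 0. Since \<open>h\<^sub>1\<^sub>1\<close> cancels, the metric depends on \<open>y\<close>
  alone: homogeneity gives \<open>G = 0\<close>, and \<open>\<delta>/\<delta>x\<^sup>i\<close> acts as \<open>\<kappa>/2\<close> times \<open>\<partial>/\<partial>y\<^sup>i\<close>, giving \<open>L\<close>.
\<close>

section \<open>Partial derivatives along the coordinate axes\<close>

abbreviation has_partial :: "4 \<Rightarrow> (real ^ 4 \<Rightarrow> real) \<Rightarrow> real \<Rightarrow> real ^ 4 \<Rightarrow> bool" where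
  "has_partial i f D v \<equiv> ((\<lambda>s. f (v + s *\<^sub>R axis i 1)) has_real_derivative D) (at 0)"

lemma partial_eqI: "has_partial i f D v \<Longrightarrow> partial i f v = D"
  unfolding partial_def by (rule DERIV_imp_deriv)

text \<open>Closed forms for first derivatives and for the metric are available only where
  \<open>S\<close> is nonzero. That set is open, so agreement near \<open>v\<close> is enough to
  differentiate them once more.\<close>

lemma partial_cong_ev:
  assumes "eventually (\<lambda>z. f z = g z) (nhds v)"
  shows "partial i f v = partial i g v"
proof -
  have "((\<lambda>s. v + s *\<^sub>R axis i 1) \<longlongrightarrow> v + 0 *\<^sub>R axis i 1) (nhds 0)"
    by (intro tendsto_intros) (auto intro: filterlim_ident)
  then have "eventually (\<lambda>s. f (v + s *\<^sub>R axis i 1) = g (v + s *\<^sub>R axis i 1)) (nhds 0)"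
    using assms by (auto simp: filterlim_iff)
  then show ?thesis
    unfolding partial_def by (rule deriv_cong_ev) simp
qed

lemma has_partial_component: "has_partial i (\<lambda>v. v $ k) (kron i k) v"
  by (auto simp: kron_def axis_def intro!: derivative_eq_intros)

section \<open>Derivatives of the cubic form and Euler's identities\<close>

text \<open>The six orderings of each monomial cancel the factor 1/6 in \<open>S3\<close>. In this
  form derivatives can be written uniformly in the index, and Euler's identities become termwise
  comparisons.\<close>

lemma S_polarised: "S y = (\<Sum>i\<in>UNIV. \<Sum>j\<in>UNIV. \<Sum>k\<in>UNIV. S3 i j k * y $ i * y $ j * y $ k)"
  by (simp add: S_def S3_def sum_4 fact_numeral algebra_simps)

lemma S3_commute: "S3 i j k = S3 j i k" "S3 i j k = S3 i k j"
  by (auto simp: S3_def)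

lemma has_partial_S:
  "has_partial i S (3 * (\<Sum>j\<in>UNIV. \<Sum>k\<in>UNIV. S3 i j k * y $ j * y $ k)) y"
proof -
  have "has_partial i S (\<Sum>j\<in>UNIV. \<Sum>k\<in>UNIV. \<Sum>l\<in>UNIV. S3 j k l *
      (kron i j * y $ k * y $ l + y $ j * kron i k * y $ l + y $ j * y $ k * kron i l)) y"
    unfolding S_polarised
    by (rule derivative_eq_intros has_partial_component refl)+ (simp add: algebra_simps)
  \<comment> \<open>The three product-rule terms agree because \<open>S3\<close> is symmetric; hence
    the factor 3.\<close>
  also have "(\<Sum>j\<in>UNIV. \<Sum>k\<in>UNIV. \<Sum>l\<in>UNIV. S3 j k l *
      (kron i j * y $ k * y $ l + y $ j * kron i k * y $ l + y $ j * y $ k * kron i l))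
    = 3 * (\<Sum>j\<in>UNIV. \<Sum>k\<in>UNIV. S3 i j k * y $ j * y $ k)"
    using exhaust_4[of i] by (auto simp: S3_def kron_def sum_4 fact_numeral)
  finally show ?thesis .
qed

lemma S1_eq: "S1 i y = 3 * (\<Sum>j\<in>UNIV. \<Sum>k\<in>UNIV. S3 i j k * y $ j * y $ k)"
  unfolding S1_def by (rule partial_eqI[OF has_partial_S])

lemma has_partial_S1:
  "has_partial i (S1 j) (6 * (\<Sum>k\<in>UNIV. S3 i j k * y $ k)) y"
proof -
  have "has_partial i (S1 j) (3 * (\<Sum>k\<in>UNIV. \<Sum>l\<in>UNIV. S3 j k l *
      (kron i k * y $ l + y $ k * kron i l))) y"
    unfolding S1_eq
    by (rule derivative_eq_intros has_partial_component refl)+ (simp add: algebra_simps)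
  also have "3 * (\<Sum>k\<in>UNIV. \<Sum>l\<in>UNIV. S3 j k l * (kron i k * y $ l + y $ k * kron i l))
    = 6 * (\<Sum>k\<in>UNIV. S3 i j k * y $ k)"
    using exhaust_4[of i] by (auto simp: S3_def kron_def sum_4 fact_numeral)
  finally show ?thesis .
qed

lemma S2_eq: "S2 i j y = 6 * (\<Sum>k\<in>UNIV. S3 i j k * y $ k)"
proof -
  have "partial j S = S1 j" by (simp add: fun_eq_iff S1_def)
  then show ?thesis
    unfolding S2_def using partial_eqI[OF has_partial_S1] by simp
qed

lemma S2_commute: "S2 i j y = S2 j i y"
  unfolding S2_eq by (simp add: S3_commute(1)[of i j])

lemma has_partial_S2: "has_partial k (S2 i j) (6 * S3 i j k) y"
proof -
  have "has_partial k (S2 i j) (6 * (\<Sum>l\<in>UNIV. S3 i j l * kron k l)) y"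
    unfolding S2_eq
    by (rule derivative_eq_intros has_partial_component refl)+ (simp add: mult.commute)
  then show ?thesis
    by (simp add: kron_def if_distrib cong: if_cong)
qed

lemma euler_S: "(\<Sum>i\<in>UNIV. S1 i y * y $ i) = 3 * S y"
  unfolding S_polarised S1_eq
  by (simp add: sum_distrib_left sum_distrib_right algebra_simps)

lemma euler_S1: "(\<Sum>j\<in>UNIV. S2 i j y * y $ j) = 2 * S1 i y"
  unfolding S2_eq S1_eq
  by (simp add: sum_distrib_left sum_distrib_right algebra_simps)

lemma euler_S2: "(\<Sum>k\<in>UNIV. S3 i j k * y $ k) = S2 i j y / 6"
  unfolding S2_eq by simp

section \<open>Inverse matrices and the inverse of \<open>S2\<close>\<close>

lemma matrix_inv_right_left:
  fixes A :: "real ^ 'n ^ 'n"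
  assumes "invertible A"
  shows "A ** matrix_inv A = mat 1" "matrix_inv A ** A = mat 1"
  using someI_ex[OF assms[unfolded invertible_def]] by (auto simp: matrix_inv_def)

lemma matrix_inv_eqI:
  fixes A B :: "real ^ 'n ^ 'n"
  assumes "A ** B = mat 1"
  shows "matrix_inv A = B"
  by (metis assms invertible_right_inverse matrix_inv_right_left(2) matrix_mul_assoc
      matrix_mul_lid matrix_mul_rid)

text \<open>This is Euler's identity \<open>euler_S1\<close> solved for \<open>y\<close>. Both sides
  of multiplication are covered: the metric inverse is verified with \<open>S2_inv\<close> on the
  right, while \<open>C\<close> contracts with it on the left.\<close>

lemma S2_inv_euler:
  assumes "invertible (S2_matrix y)"
  shows "(\<Sum>k\<in>UNIV. S2_inv j k y * S1 k y) = y $ j / 2"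
    and "(\<Sum>k\<in>UNIV. S1 k y * S2_inv k j y) = y $ j / 2"
proof -
  let ?A = "S2_matrix y" and ?w = "\<chi> k. 2 * S1 k y"
  have "?A *v y = ?w"
    by (simp add: vec_eq_iff matrix_vector_mult_def S2_matrix_def euler_S1)
  then have "matrix_inv ?A *v ?w = y"
    by (metis assms matrix_inv_right_left(2) matrix_vector_mul_assoc matrix_vector_mul_lid)
  then have "2 * (\<Sum>k\<in>UNIV. S2_inv j k y * S1 k y) = y $ j"
    by (auto simp: vec_eq_iff matrix_vector_mult_def S2_inv_def sum_distrib_left algebra_simps)
  then show "(\<Sum>k\<in>UNIV. S2_inv j k y * S1 k y) = y $ j / 2" by simp
  \<comment> \<open>Symmetry of \<open>S2\<close> turns the column identity into one for row
    vectors.\<close>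
  have "y v* ?A = ?w"
    unfolding vec_eq_iff
    by (simp add: vector_matrix_mult_def S2_matrix_def S2_commute mult.commute
        euler_S1[symmetric, unfolded mult.commute[of 2]])
  then have "?w v* matrix_inv ?A = y"
    by (metis assms matrix_inv_right_left(1) vector_matrix_mul_assoc vector_matrix_mul_rid)
  then have "2 * (\<Sum>k\<in>UNIV. S1 k y * S2_inv k j y) = y $ j"
    by (auto simp: vec_eq_iff vector_matrix_mult_def S2_inv_def sum_distrib_left algebra_simps)
  then show "(\<Sum>k\<in>UNIV. S1 k y * S2_inv k j y) = y $ j / 2" by simp
qed

section \<open>The cube root factor\<close>

lemma DERIV_root_3:
  assumes "z \<noteq> 0"
  shows "(root 3 has_real_derivative inverse (3 * (root 3 z)\<^sup>2)) (at z)"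
  using DERIV_odd_real_root[of 3 z] assms by simp

text \<open>With the factor \<open>q = S\<^sup>-\<^sup>1\<^sup>/\<^sup>3\<close>, the metric and all its derivatives are polynomials in \<open>q\<close>, \<open>S1\<close>,
  \<open>S2\<close> and \<open>S3\<close>.\<close>

definition q :: "real ^ 4 \<Rightarrow> real" where
  "q y = inverse (root 3 (S y))"

lemma q_nonzero: "S y \<noteq> 0 \<Longrightarrow> q y \<noteq> 0"
  by (simp add: q_def)

text \<open>Since the cube of \<open>q\<close> is 1/\<open>S\<close>, every term of the metric and
  of its derivatives becomes \<open>q\<close> times a rational expression, and this \<open>q\<close>
  cancels against the \<open>3 / q\<close> of the inverse metric.\<close>

lemma q_powers:
  assumes "S y \<noteq> 0"
  shows "q y ^ 4 = q y / S y" "q y ^ 7 = q y / (S y)\<^sup>2"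
proof -
  have "q y ^ 3 = 1 / S y"
    by (simp add: q_def inverse_eq_divide power_one_over odd_real_root_pow)
  then show "q y ^ 4 = q y / S y" "q y ^ 7 = q y / (S y)\<^sup>2"
    using power_add[of "q y" 3 1] power_add[of "q y" 3 4] by (simp_all add: power2_eq_square)
qed

lemma has_partial_q:
  assumes "S y \<noteq> 0"
  shows "has_partial i q (- (S1 i y * q y ^ 4 / 3)) y"
proof -
  \<comment> \<open>The base point is written as the value of the inner curve at 0, the shape the
    chain rule expects.\<close>
  have "((root 3) has_real_derivative inverse (3 * (root 3 (S y))\<^sup>2)) (at (S (y + 0 *\<^sub>R axis i 1)))"
    using DERIV_root_3 assms by simp
  from DERIV_chain2[OF this has_partial_S[folded S1_eq]]
  have "has_partial i (\<lambda>z. root 3 (S z)) (inverse (3 * (root 3 (S y))\<^sup>2) * S1 i y) y" .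
  from DERIV_inverse_fun[OF this] assms show ?thesis
    by (simp add: q_def[abs_def] field_simps eval_nat_numeral)
qed

lemma eventually_S_nonzero:
  assumes "S y \<noteq> 0"
  shows "eventually (\<lambda>z. S z \<noteq> 0) (nhds y)"
proof -
  have "continuous_on UNIV S"
    unfolding S_def by (intro continuous_intros)
  then have "open {z. S z \<noteq> 0}"
    by (intro open_Collect_neq) auto
  with assms show ?thesis
    by (auto simp: eventually_nhds)
qed

section \<open>The metric, its \<open>y\<close>-derivatives and its inverse\<close>

lemma partial_chernov_sq:
  assumes "h t > 0" "S y \<noteq> 0"
  shows "partial j (\<lambda>z. (chernov_F h t x z)\<^sup>2) y = 2 / (3 * h t) * (S1 j y * q y)"
proof (rule partial_eqI)
  let ?r = "root 3 (S y)"
  have r: "?r \<noteq> 0" using assms by simp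
  have "((\<lambda>u. 1 / h t * (root 3 u)\<^sup>2) has_real_derivative 1 / h t * (2 * ?r * inverse (3 * ?r\<^sup>2)))
      (at (S (y + 0 *\<^sub>R axis j 1)))"
    using assms by (auto intro!: derivative_eq_intros DERIV_root_3 simp: mult_ac)
  from DERIV_chain2[OF this has_partial_S[folded S1_eq]]
  have "has_partial j (\<lambda>z. 1 / h t * (root 3 (S z))\<^sup>2)
      (1 / h t * (2 * ?r * inverse (3 * ?r\<^sup>2)) * S1 j y) y" .
  moreover have "1 / h t * (2 * ?r * inverse (3 * ?r\<^sup>2)) * S1 j y = 2 / (3 * h t) * (S1 j y * q y)"
    using assms(1) r by (simp add: q_def field_simps power2_eq_square)
  moreover have "(chernov_F h t x z)\<^sup>2 = 1 / h t * (root 3 (S z))\<^sup>2" for z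
    using assms(1) by (simp add: chernov_F_def h_up_def power_mult_distrib)
  ultimately show "has_partial j (\<lambda>z. (chernov_F h t x z)\<^sup>2) (2 / (3 * h t) * (S1 j y * q y)) y"
    by simp
qed

lemma metric_chernov:
  assumes "h t > 0" "S y \<noteq> 0"
  shows "metric h (chernov_F h) i j t x y = S2 i j y * q y / 3 - S1 i y * S1 j y * q y ^ 4 / 9"
proof -
  have "partial i (partial j (\<lambda>z. (chernov_F h t x z)\<^sup>2)) y
      = partial i (\<lambda>z. 2 / (3 * h t) * (S1 j z * q z)) y"
    using partial_chernov_sq[of h t, OF assms(1)]
    by (intro partial_cong_ev eventually_mono[OF eventually_S_nonzero[OF assms(2)]]) auto
  also have "has_partial i (\<lambda>z. 2 / (3 * h t) * (S1 j z * q z))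
      (2 / (3 * h t) * (S2 i j y * q y - S1 i y * S1 j y * q y ^ 4 / 3)) y"
    by (rule has_partial_q has_partial_S1[folded S2_eq] assms(2) derivative_eq_intros refl)+
       (simp add: algebra_simps)
  note partial_eqI[OF this]
  finally show ?thesis
    using assms(1) by (simp add: metric_def field_simps)
qed

lemma partial_metric_chernov:
  assumes "h t > 0" "S y \<noteq> 0"
  shows "partial k (metric h (chernov_F h) i j t x) y
    = 2 * S3 i j k * q y
      - (S2 i j y * S1 k y + S2 i k y * S1 j y + S2 j k y * S1 i y) * q y ^ 4 / 9
      + 4 * S1 i y * S1 j y * S1 k y * q y ^ 7 / 27" (is "_ = ?D")
proof -
  have "partial k (metric h (chernov_F h) i j t x) y
      = partial k (\<lambda>z. S2 i j z * q z * (1 / 3) - S1 i z * S1 j z * q z ^ 4 * (1 / 9)) y"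
    using metric_chernov[of h t, OF assms(1)]
    by (intro partial_cong_ev eventually_mono[OF eventually_S_nonzero[OF assms(2)]]) auto
  also have "has_partial k (\<lambda>z. S2 i j z * q z * (1 / 3) - S1 i z * S1 j z * q z ^ 4 * (1 / 9)) ?D y"
    by (rule has_partial_q has_partial_S2 has_partial_S1[folded S2_eq] assms(2)
          derivative_eq_intros refl)+
       (simp add: S2_commute[of k] algebra_simps eval_nat_numeral)
  note partial_eqI[OF this]
  finally show ?thesis .
qed

text \<open>The closed form of the derivative is symmetric in all three indices, so the three-term
  combination in \<open>cartan_C\<close> collapses to a single derivative.\<close>

lemma partial_metric_chernov_commute:
  assumes "h t > 0" "S y \<noteq> 0"
  shows "partial k (metric h (chernov_F h) j m t x) y = partial m (metric h (chernov_F h) j k t x) y"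
    and "partial j (metric h (chernov_F h) k m t x) y = partial m (metric h (chernov_F h) j k t x) y"
  unfolding partial_metric_chernov[of h t, OF assms]
  by (simp_all add: S2_commute S3_commute algebra_simps)

text \<open>The metric is \<open>q / 3\<close> times \<open>S2\<close> minus the outer square of
  \<open>S1\<close> over \<open>3 * S\<close>. In the Sherman-Morrison formula \<open>S2_inv\<close>
  sends \<open>S1\<close> to \<open>y / 2\<close>, and the denominator is 1 - 1/2 by
  \<open>euler_S\<close>; this yields the coefficient \<open>1 / (6 * S y)\<close>.\<close>

lemma metric_inv_chernov:
  assumes "h t > 0" "S y \<noteq> 0" "invertible (S2_matrix y)"
  shows "metric_inv h (chernov_F h) j k t x y
    = 3 / q y * (S2_inv j k y + y $ j * y $ k / (6 * S y))"
proof -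
  let ?A = "\<chi> a b. metric h (chernov_F h) a b t x y"
  let ?B = "\<chi> a b. 3 / q y * (S2_inv a b y + y $ a * y $ b / (6 * S y))"
  have inv: "(\<Sum>m\<in>UNIV. S2 a m y * S2_inv m b y) = kron a b" for a b
    using matrix_inv_right_left(1)[OF assms(3)]
    by (simp add: vec_eq_iff matrix_matrix_mult_def S2_matrix_def S2_inv_def mat_def kron_def)
  have "(?A ** ?B) $ a $ b = mat 1 $ a $ b" for a b
  proof -
    \<comment> \<open>Each summand isolates its \<open>m\<close>-dependent factor, so that every sum
      is a known contraction.\<close>
    have "(?A ** ?B) $ a $ b = (\<Sum>m\<in>UNIV. S2 a m y * S2_inv m b y
        + (S2 a m y * y $ m) * (y $ b / (6 * S y)) - (S1 m y * S2_inv m b y) * (S1 a y / (3 * S y))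
        - (S1 m y * y $ m) * (S1 a y * y $ b / (18 * (S y)\<^sup>2)))"
      using assms(2) q_nonzero[OF assms(2)]
      by (simp add: matrix_matrix_mult_def metric_chernov[of h t, OF assms(1,2)] q_powers[OF assms(2)])
         (intro sum.cong refl, simp add: field_simps power2_eq_square)
    also have "\<dots> = kron a b + 2 * S1 a y * (y $ b / (6 * S y))
        - y $ b / 2 * (S1 a y / (3 * S y)) - 3 * S y * (S1 a y * y $ b / (18 * (S y)\<^sup>2))"
      by (simp only: sum.distrib sum_subtractf inv S2_inv_euler(2)[OF assms(3)] euler_S euler_S1 flip: sum_distrib_right)
    also have "\<dots> = kron a b"
      using assms(2) by (simp add: field_simps power2_eq_square)
    finally show ?thesis by (simp add: kron_def mat_def)
  qed
  then have "?A ** ?B = mat 1" by (simp add: vec_eq_iff)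
  from matrix_inv_eqI[OF this] show ?thesis
    by (simp add: metric_inv_def)
qed

section \<open>The adapted components of the Cartan connection\<close>

lemma cartan_C_chernov:
  assumes "h t > 0" "S y \<noteq> 0" "invertible (S2_matrix y)"
  shows "cartan_C h (chernov_F h) i j k t x y =
           3 * (\<Sum>m\<in>UNIV. S2_inv i m y * S3 j k m)
           - 1 / 6 * (1 / S y) *
               (S2 j k y * (y $ i / 2) + kron i j * S1 k y + kron i k * S1 j y)
           + 1 / 9 * (1 / (S y)\<^sup>2) * S1 j y * S1 k y * y $ i"
proof -
  have inv: "(\<Sum>m\<in>UNIV. S2_inv i m y * S2 j m y) = kron i j" for j
    using matrix_inv_right_left(2)[OF assms(3)]
    by (simp add: vec_eq_iff matrix_matrix_mult_def S2_matrix_def S2_inv_def mat_def kron_def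
        S2_commute[of j])
  have "cartan_C h (chernov_F h) i j k t x y = (\<Sum>m\<in>UNIV. metric_inv h (chernov_F h) i m t x y / 2 *
      partial m (metric h (chernov_F h) j k t x) y)"
    unfolding cartan_C_def delta_y_def
    by (simp only: partial_metric_chernov_commute(1)[of h t y k j, OF assms(1,2)]
        partial_metric_chernov_commute(2)[of h t y j k, OF assms(1,2)] add_diff_cancel_right'
        times_divide_eq_left)
  \<comment> \<open>The first five terms come from \<open>S2_inv\<close>, the last five from the
    \<open>y\<close>-\<open>y\<close> part of the inverse metric.\<close>
  also have "\<dots> = (\<Sum>m\<in>UNIV. 3 * (S2_inv i m y * S3 j k m)
      - (S2_inv i m y * S1 m y) * (S2 j k y / (6 * S y))
      - (S2_inv i m y * S2 j m y) * (S1 k y / (6 * S y))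
      - (S2_inv i m y * S2 k m y) * (S1 j y / (6 * S y))
      + (S2_inv i m y * S1 m y) * (2 * S1 j y * S1 k y / (9 * (S y)\<^sup>2))
      + (S3 j k m * y $ m) * (y $ i / (2 * S y))
      - (S1 m y * y $ m) * (S2 j k y * y $ i / (36 * (S y)\<^sup>2))
      - (S2 j m y * y $ m) * (S1 k y * y $ i / (36 * (S y)\<^sup>2))
      - (S2 k m y * y $ m) * (S1 j y * y $ i / (36 * (S y)\<^sup>2))
      + (S1 m y * y $ m) * (S1 j y * S1 k y * y $ i / (27 * (S y) ^ 3)))"
    using assms(2) q_nonzero[OF assms(2)]
    unfolding partial_metric_chernov[of h t, OF assms(1,2)] metric_inv_chernov[of h t, OF assms] q_powers[OF assms(2)]
    by (intro sum.cong refl) (simp add: field_simps power2_eq_square power3_eq_cube)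
  also have "\<dots> = 3 * (\<Sum>m\<in>UNIV. S2_inv i m y * S3 j k m)
      - (y $ i / 2) * (S2 j k y / (6 * S y))
      - kron i j * (S1 k y / (6 * S y))
      - kron i k * (S1 j y / (6 * S y))
      + (y $ i / 2) * (2 * S1 j y * S1 k y / (9 * (S y)\<^sup>2))
      + (S2 j k y / 6) * (y $ i / (2 * S y))
      - (3 * S y) * (S2 j k y * y $ i / (36 * (S y)\<^sup>2))
      - (2 * S1 j y) * (S1 k y * y $ i / (36 * (S y)\<^sup>2))
      - (2 * S1 k y) * (S1 j y * y $ i / (36 * (S y)\<^sup>2))
      + (3 * S y) * (S1 j y * S1 k y * y $ i / (27 * (S y) ^ 3))"
    by (simp only: sum.distrib sum_subtractf inv S2_inv_euler[OF assms(3)] euler_S euler_S1 euler_S2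
        flip: sum_distrib_right sum_distrib_left)
  \<comment> \<open>The last five terms cancel, reflecting homogeneity of degree 0; the fifth gives
    the coefficient 1/9.\<close>
  also have "\<dots> = 3 * (\<Sum>m\<in>UNIV. S2_inv i m y * S3 j k m)
           - 1 / 6 * (1 / S y) *
               (S2 j k y * (y $ i / 2) + kron i j * S1 k y + kron i k * S1 j y)
           + 1 / 9 * (1 / (S y)\<^sup>2) * S1 j y * S1 k y * y $ i"
    using assms(2) by (simp add: field_simps power2_eq_square power3_eq_cube)
  finally show ?thesis .
qed

text \<open>The metric is constant in \<open>x\<close>, so only the vertical part of the adapted
  derivation survives.\<close>

lemma delta_x_metric_chernov:
  "delta_x h k (metric h (chernov_F h) i j) t x y
    = kappa h t / 2 * delta_y k (metric h (chernov_F h) i j) t x y"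
  by (simp add: delta_x_eq delta_y_def metric_def chernov_F_def partial_def)

lemma cartan_L_chernov:
  "cartan_L h (chernov_F h) i j k t x y = kappa h t / 2 * cartan_C h (chernov_F h) i j k t x y"
  unfolding cartan_L_def cartan_C_def delta_x_metric_chernov sum_distrib_left
  by (intro sum.cong refl) (simp add: algebra_simps)

text \<open>Positivity of \<open>h\<close> at every time makes the metric constant in
  \<open>t\<close> at fixed \<open>y\<close>. What remains is a multiple of the Euler operator in
  \<open>y\<close>, which kills functions of degree 0.\<close>

lemma delta_t_metric_chernov:
  assumes "\<And>t. h t > 0" "S y \<noteq> 0"
  shows "delta_t h (metric h (chernov_F h) i j) t x y = 0"
proof -
  have "(\<Sum>p\<in>UNIV. y $ p * partial p (metric h (chernov_F h) i j t x) y)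
    = (\<Sum>p\<in>UNIV. (S3 i j p * y $ p) * (2 * q y) - (S1 p y * y $ p) * (S2 i j y * q y / (9 * S y))
      - (S2 i p y * y $ p) * (S1 j y * q y / (9 * S y)) - (S2 j p y * y $ p) * (S1 i y * q y / (9 * S y))
      + (S1 p y * y $ p) * (4 * S1 i y * S1 j y * q y / (27 * (S y)\<^sup>2)))"
    unfolding partial_metric_chernov[of h t, OF assms] q_powers[OF assms(2)]
    by (intro sum.cong refl) (simp add: add_divide_distrib algebra_simps)
  also have "\<dots> = (S2 i j y / 6) * (2 * q y) - (3 * S y) * (S2 i j y * q y / (9 * S y))
      - (2 * S1 i y) * (S1 j y * q y / (9 * S y)) - (2 * S1 j y) * (S1 i y * q y / (9 * S y))
      + (3 * S y) * (4 * S1 i y * S1 j y * q y / (27 * (S y)\<^sup>2))"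
    by (simp only: sum.distrib sum_subtractf euler_S euler_S1 euler_S2 flip: sum_distrib_right)
  also have "\<dots> = 0"
    using assms(2) by (simp add: field_simps power2_eq_square)
  finally show ?thesis
    by (simp add: delta_t_eq metric_chernov[of h, OF assms])
qed

lemma cartan_G_chernov:
  assumes "\<And>t. h t > 0" "S y \<noteq> 0"
  shows "cartan_G h (chernov_F h) k j t x y = 0"
  by (simp add: cartan_G_def delta_t_metric_chernov assms)

theorem theorem4p1:
  fixes h :: "real \<Rightarrow> real" and t :: real and x y :: "real ^ 4"
  assumes "riemannian_metric_line h"
    and "S y \<noteq> 0"
    and "invertible (S2_matrix y)"
  shows "cartan_connection h (chernov_F h) t x y =
           (kappa h t,
            \<lambda>k j. 0,
            \<lambda>i j k. kappa h t / 2 * cartan_C h (chernov_F h) i j k t x y,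
            \<lambda>i j k. cartan_C h (chernov_F h) i j k t x y)
         \<and> (\<forall>i j k. cartan_C h (chernov_F h) i j k t x y =
           3 * (\<Sum>m\<in>UNIV. S2_inv i m y * S3 j k m)
           - 1 / 6 * (1 / S y) *
               (S2 j k y * (y $ i / 2) + kron i j * S1 k y + kron i k * S1 j y)
           + 1 / 9 * (1 / (S y)\<^sup>2) * S1 j y * S1 k y * y $ i)"
proof -
  have h: "h t > 0" for t
    using assms(1) by (simp add: riemannian_metric_line_def)
  show ?thesis
    unfolding cartan_connection_def cartan_G_chernov[of h, OF h assms(2)] cartan_L_chernov
    using cartan_C_chernov[of h t, OF h assms(2,3)] by simp
qed

end
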